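(* Let $k\ge 2$ and $d\ge k$ be integers, and let $C$ be a circuit in $I(d)$ of length $N>4(k-1)$ whose transition sequence uses every one of the $d$ coordinates. Then $C$ has spread $k$ (i.e. $C$ is a $(d,k)$ circuit code) if and only if for every $i=1,\ldots,d$ the subcircuit code $C^i$ is a $(d-1,k-1)$ circuit code.
   Context: $I(d)$ is the graph of the $d$-dimensional hypercube (vertices are binary vectors of length $d$; edges join vectors differing in exactly one position). For a graph $G$, $d_G(x,y)$ is the graph distance in $G$. A circuit in $I(d)$ is a simple cycle $C=(x_1,\ldots,x_N)$ in $I(d)$; its length is $N$. A $(d,k)$ circuit code (circuit code of spread $k$ in dimension $d$) is a circuit $C$ in $I(d)$ such that for all vertices $x,y$ of $C$, $d_{I(d)}(x,y)<k$ implies $d_C(x,y)=d_{I(d)}(x,y)$. By convention $x_1=\vec 0$. The transition sequence of $C$ is $T=(\tau_1,\ldots,\tau_N)$, where $\tau_i\in\{1,\ldots,d\}$ is the position in which $x_i$ and $x_{i+1}$ differ (with $x_{N+1}=x_1$). The distinct values occurring in $T$ are the transition elements $t_1,\ldots,t_d$. For each $i\in\{1,\ldots,d\}$, $T^i$ is the subsequence of $T$ obtained by deleting all occurrences of $t_i$, and the $i$th subcircuit code $C^i$ is the closed walk, starting at the zero vector, induced by the transition sequence $T^i$; since coordinate $t_i$ is never flipped, it is regarded as a closed walk in the $(d-1)$-dimensional hypercube $I(d-1)$ on the remaining $d-1$ coordinates. Saying that $C^i$ is a $(d-1,k-1)$ circuit code means that this closed walk traverses once a simple cycle in $I(d-1)$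 and that this cycle has spread $k-1$. *)

theory Defs
  imports Main
begin

text \<open>Binary vectors of length \<open>d\<close> are lists of type \<^typ>\<open>bool list\<close>; coordinates are numbered
  \<open>0, \<dots>, d - 1\<close>.  A graph is given by its (symmetric) edge relation, so \<open>E ^^ n\<close> relates the
  endpoints of the walks of length \<open>n\<close>.\<close>

definition hypercube :: "nat \<Rightarrow> (bool list \<times> bool list) set" where
  "hypercube d = {(x, y). length x = d \<and> length y = d \<and> (\<exists>!p. p < d \<and> x ! p \<noteq> y ! p)}"

text \<open>The value is unspecified if \<open>x\<close> and \<open>y\<close> are not connected; hypercubes and
  cycles are connected.\<close>
definition graph_dist :: "('a \<times> 'a) set \<Rightarrow> 'a \<Rightarrow> 'a \<Rightarrow> nat" where
  "graph_dist E x y = (LEAST n. (x, y) \<in> E ^^ n)"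

text \<open>A circuit \<open>(x\<^sub>1, \<dots>, x\<^sub>N)\<close> is the list of its vertices, the starting vertex not being
  repeated at the end.\<close>
definition cycle_graph :: "'a list \<Rightarrow> ('a \<times> 'a) set" where
  "cycle_graph C = (\<Union>j<length C. {(C ! j, C ! (Suc j mod length C)),
                                   (C ! (Suc j mod length C), C ! j)})"

definition circuit :: "nat \<Rightarrow> bool list list \<Rightarrow> bool" where
  "circuit d C \<longleftrightarrow> 3 \<le> length C \<and> distinct C \<and>
     (\<forall>j<length C. (C ! j, C ! (Suc j mod length C)) \<in> hypercube d)"

definition circuit_code :: "nat \<Rightarrow> nat \<Rightarrow> bool list list \<Rightarrow> bool" where
  "circuit_code d k C \<longleftrightarrow> circuit d C \<and>
     (\<forall>x\<in>set C. \<forall>y\<in>set C. graph_dist (hypercube d) x y < k \<longrightarrow>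
        graph_dist (cycle_graph C) x y = graph_dist (hypercube d) x y)"

definition transition :: "bool list \<Rightarrow> bool list \<Rightarrow> nat" where
  "transition x y = (THE p. p < length x \<and> x ! p \<noteq> y ! p)"

definition transition_sequence :: "bool list list \<Rightarrow> nat list" where
  "transition_sequence C =
     map (\<lambda>j. transition (C ! j) (C ! (Suc j mod length C))) [0..<length C]"

text \<open>As for circuits, the vertex reached by the last transition is left out: a closed walk
  with \<open>M\<close> transitions is a list of \<open>M\<close> vertices.\<close>
fun walk :: "bool list \<Rightarrow> nat list \<Rightarrow> bool list list" where
  "walk x [] = []"
| "walk x (t # ts) = x # walk (x[t := \<not> x ! t]) ts"

definition delete_coord :: "nat \<Rightarrow> bool list \<Rightarrow> bool list" where
  "delete_coord i x = take i x @ drop (Suc i) x"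

text \<open>The walk induced by the transition sequence of \<open>C\<close> without the transitions in
  coordinate \<open>i\<close>, with the unused coordinate \<open>i\<close> dropped from its vertices.\<close>
definition subcircuit :: "nat \<Rightarrow> nat \<Rightarrow> bool list list \<Rightarrow> bool list list" where
  "subcircuit d i C =
     map (delete_coord i)
       (walk (replicate d False) (filter (\<lambda>t. t \<noteq> i) (transition_sequence C)))"

end

theory Submission imports Defs begin

text \<open>The distance of two vertices of a closed walk in the cube is the number of coordinates
  occurring an odd number of times in either of the two arcs \<open>S\<close>, \<open>R\<close> of the cyclic transition
  word between them, so spread \<open>k\<close> says that this number is at least
  \<open>min k (min |S| |R|)\<close> for all pairs of complementary arcs.

  If \<open>T\<close> has spread \<open>k\<close>, then \<open>k\<close> consecutive letters of \<open>T\<close> are distinct. Hence fewer than \<open>k\<close>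
  consecutive letters of \<open>T\<^sup>i\<close> are distinct, and on longer arcs deleting \<open>i\<close> costs at
  most one odd letter.

  Conversely, let \<open>S\<close> be an arc violating spread \<open>k\<close>, no longer than \<open>R\<close>, with
  \<open>D < min k |S|\<close> odd letters. Deleting an odd letter \<open>i\<close> leaves at most \<open>D - 1\<close>
  letters of \<open>S\<close> or of \<open>R\<close>. Adjacent letters differ, so the latter would give \<open>|R| \<le> 2D - 1\<close> and
  \<open>N \<le> 4D - 2 \<le> 4(k - 1)\<close>. In the former case the letters of \<open>S\<close> other than \<open>i\<close> occur once, and
  using a second odd letter in place of \<open>i\<close> yields \<open>|S| \<le> D\<close>.\<close>

section \<open>Odd letters and spread of cyclic words\<close>

definition parity_weight :: "'a list \<Rightarrow> nat" where
  "parity_weight S = card {c. odd (count_list S c)}"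

text \<open>The words of closed walks: every coordinate is flipped back.\<close>

definition balanced :: "'a list \<Rightarrow> bool" where
  "balanced T \<longleftrightarrow> (\<forall>c. even (count_list T c))"

text \<open>For \<open>k = 1\<close> the condition says that no arc other than the empty and the
  full one has weight 0, that is, no vertex is repeated.\<close>

definition spread :: "nat \<Rightarrow> 'a list \<Rightarrow> bool" where
  "spread k T \<longleftrightarrow>
     (\<forall>p S R. rotate p T = S @ R \<longrightarrow> min k (min (length S) (length R)) \<le> parity_weight S)"

lemma odd_letters_subset: "{c. odd (count_list S c)} \<subseteq> set S"
  using count_notin by fastforce

lemma finite_odd_letters [simp]: "finite {c. odd (count_list S c)}"
  by (rule finite_subset[OF odd_letters_subset]) simp

lemma parity_weight_le_card: "parity_weight S \<le> card (set S)"
  unfolding parity_weight_def by (intro card_mono odd_letters_subset) simp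

lemma parity_weight_le_length: "parity_weight S \<le> length S"
  using parity_weight_le_card[of S] card_length[of S] by linarith

lemma count_list_distinct: "distinct S \<Longrightarrow> count_list S c = (if c \<in> set S then 1 else 0)"
  by (induction S) auto

lemma parity_weight_distinct: "distinct S \<Longrightarrow> parity_weight S = length S"
  by (simp add: parity_weight_def count_list_distinct distinct_card)

lemma distinct_if_length_le_parity_weight: "length S \<le> parity_weight S \<Longrightarrow> distinct S"
  using parity_weight_le_card[of S] card_length[of S] by (intro card_distinct) linarith

lemma parity_weight_twice: "parity_weight [x, x] = 0"
proof -
  have "even (count_list [x, x] c)" for c by (cases "x = c") auto
  then show ?thesis by (simp add: parity_weight_def)
qed

lemma count_list_filter: "count_list (filter P S) c = (if P c then count_list S c else 0)"
  by (induction S) auto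

lemma odd_letters_filter:
  "{c. odd (count_list (filter (\<lambda>t. t \<noteq> i) S) c)} = {c. odd (count_list S c)} - {i}"
  by (auto simp: count_list_filter)

lemma parity_weight_filter_ge: "parity_weight S - 1 \<le> parity_weight (filter (\<lambda>t. t \<noteq> i) S)"
  unfolding parity_weight_def odd_letters_filter by (simp add: card_Diff_singleton_if)

lemma parity_weight_filter_odd:
  "odd (count_list S i) \<Longrightarrow> parity_weight (filter (\<lambda>t. t \<noteq> i) S) = parity_weight S - 1"
  unfolding parity_weight_def odd_letters_filter by simp

lemma length_filter_neq: "length (filter (\<lambda>t. t \<noteq> i) S) + count_list S i = length S"
  by (induction S) auto

lemma balanced_filter: "balanced T \<Longrightarrow> balanced (filter P T)"
  by (simp add: balanced_def count_list_filter)

lemma balanced_map: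
  assumes "balanced T" "inj_on f (set T)"
  shows "balanced (map f T)"
  unfolding balanced_def
proof
  fix c
  show "even (count_list (map f T) c)"
  proof (cases "c \<in> f ` set T")
    case True
    then show ?thesis using assms by (auto simp: balanced_def count_list_inj_map)
  next
    case False
    then have "count_list (map f T) c = 0" by (intro count_notin) simp
    then show ?thesis by simp
  qed
qed

lemma even_length_balanced: "balanced T \<Longrightarrow> even (length T)"
  using sum_count_set[of T "set T"] by (metis balanced_def dvd_sum finite_set order_refl)

lemma count_list_rotate: "count_list (rotate p T) c = count_list T c"
  by (metis add.commute append_take_drop_id count_list_append rotate_drop_take)

lemma balanced_rotate: "balanced T \<Longrightarrow> balanced (rotate p T)"
  by (simp add: balanced_def count_list_rotate)

text \<open>The two counts of each letter have an even sum, so both arcs have the same odd letters.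
  This transfers bounds from an arc to its complement.\<close>

lemma parity_weight_balanced_append: "balanced (S @ R) \<Longrightarrow> parity_weight R = parity_weight S"
  by (auto simp: balanced_def parity_weight_def intro!: arg_cong[where f = card])

lemma spreadD:
  assumes "spread k T" "rotate p T = S @ R"
  shows "min k (min (length S) (length R)) \<le> parity_weight S"
  using assms by (auto simp: spread_def)

text \<open>Cyclically every infix is a prefix, so \<open>spreadD\<close> reaches arcs in the middle
  of a word; \<open>B = []\<close> exchanges an arc and its complement.\<close>

lemma rotate_infix:
  assumes "rotate p T = A @ S @ B"
  shows "rotate (p + length A) T = S @ B @ A"
proof -
  have "rotate (p + length A) T = rotate (length A) (A @ S @ B)"
    using assms by (metis add.commute rotate_rotate)
  then show ?thesis by (simp add: rotate_append)
qed

lemma parity_weight_map: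
  assumes "inj_on f (set S)"
  shows "parity_weight (map f S) = parity_weight S"
proof -
  have "{c. odd (count_list (map f S) c)} = f ` {c. odd (count_list S c)}"
    (is "?L = _")
  proof -
    have "?L = f ` {c \<in> set S. odd (count_list (map f S) (f c))}"
      using odd_letters_subset[of "map f S"] by auto
    also have "{c \<in> set S. odd (count_list (map f S) (f c))} = {c. odd (count_list S c)}"
      using assms odd_letters_subset[of S] by (auto simp: count_list_inj_map)
    finally show ?thesis .
  qed
  then show ?thesis
    using assms odd_letters_subset[of S]
    by (simp add: parity_weight_def card_image inj_on_subset)
qed

text \<open>Parity weight depends only on which letters coincide. Needed because removing a
  coordinate renumbers the later ones.\<close>

lemma spread_map:
  assumes "inj_on f (set T)"
  shows "spread k (map f T) \<longleftrightarrow> spread k T"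
proof -
  have pw: "parity_weight (map f S) = parity_weight S" if "rotate p T = S @ R" for p S R
  proof -
    have "set S \<subseteq> set T"
      using that by (metis le_sup_iff order_refl set_append set_rotate)
    then show ?thesis using assms by (intro parity_weight_map) (rule inj_on_subset)
  qed
  show ?thesis
    unfolding spread_def rotate_map
    by (auto simp: map_eq_append_conv pw) (metis length_map map_append pw)+
qed

section \<open>Cuts of a filtered cyclic word\<close>

lemma filter_eq_appendE:
  assumes "filter P T = S' @ R'"
  obtains S R where "T = S @ R" "filter P S = S'" "filter P R = R'"
  using assms
proof (induction T arbitrary: S' thesis)
  case Nil
  then show ?case by simp
next
  case (Cons t T)
  show ?case
  proof (cases "P t \<and> S' \<noteq> []")
    case True
    then obtain S'' where S'': "S' = t # S''" "filter P T = S'' @ R'"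
      using Cons.prems(2) by (cases S') auto
    obtain S R where "T = S @ R" "filter P S = S''" "filter P R = R'"
      using Cons.IH[OF _ S''(2)] by blast
    then show ?thesis
      using Cons.prems(1)[of "t # S" R] S''(1) True by simp
  next
    case False
    show ?thesis
    proof (cases "P t")
      case True
      then show ?thesis using Cons.prems(1)[of "[]" "t # T"] Cons.prems(2) False by simp
    next
      case not: False
      obtain S R where "T = S @ R" "filter P S = S'" "filter P R = R'"
        using Cons.IH[of S'] Cons.prems(2) not by auto
      then show ?thesis
        using Cons.prems(1)[of "t # S" R] not by simp
    qed
  qed
qed

text \<open>Arcs of \<open>filter P T\<close> are lifted to \<open>T\<close> by lifting two cuts in
  turn: the one where the rotation begins, then the one between \<open>S'\<close> and
  \<open>R'\<close>.\<close>

lemma rotate_filterE: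
  assumes "rotate q (filter P T) = S' @ R'"
  obtains p S R where "rotate p T = S @ R" "filter P S = S'" "filter P R = R'"
proof -
  let ?F = "filter P T" and ?r = "q mod length (filter P T)"
  have "?F = take ?r ?F @ drop ?r ?F" by simp
  then obtain U V where UV: "T = U @ V" "filter P U = take ?r ?F" "filter P V = drop ?r ?F"
    by (metis filter_eq_appendE)
  have "filter P (V @ U) = S' @ R'"
    using assms unfolding filter_append UV(2,3) by (simp only: rotate_drop_take)
  then obtain S R where SR: "V @ U = S @ R" "filter P S = S'" "filter P R = R'"
    by (metis filter_eq_appendE)
  have "rotate (length U) T = S @ R"
    using UV(1) SR(1) by (simp add: rotate_append)
  with SR that show thesis by blast
qed

lemma rotate_filter_append:
  assumes "rotate p T = S @ R"
  obtains q where "rotate q (filter P T) = filter P S @ filter P R"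
proof -
  let ?r = "p mod length T"
  \<comment> \<open>The witness counts the kept letters among the first
    \<open>p mod length T\<close>.\<close>
  have "filter P (rotate p T) = rotate (length (filter P (take ?r T))) (filter P T)"
    by (metis append_take_drop_id filter_append rotate_append rotate_drop_take)
  with assms that show thesis by (metis filter_append)
qed

section \<open>Spread under deletion of a letter\<close>

text \<open>Occurrences of \<open>i\<close> are separated by other letters, so they exceed these by
  at most one.\<close>

lemma length_le_double_filter_neq:
  assumes "distinct_adj S"
  shows "length S \<le> 2 * length (filter (\<lambda>t. t \<noteq> i) S) + 1"
  using assms
proof (induction S rule: induct_list012)
  case (3 x y zs)
  then show ?case
    by (cases zs) (auto split: if_splits)
qed auto

text \<open>Two equal neighbours would form an arc of weight 0; a third letter makes its complement
  nonempty, so that spread 1 forbids this.\<close>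

lemma distinct_adj_if_spread:
  assumes "spread 1 T" "3 \<le> length T"
  shows "distinct_adj (rotate p T)"
  unfolding distinct_adj_conv_nth
proof (intro allI impI notI)
  fix j assume j: "Suc j < length (rotate p T)" and eq: "rotate p T ! j = rotate p T ! Suc j"
  let ?W = "rotate p T"
  have "?W = take j ?W @ [?W ! j, ?W ! Suc j] @ drop (Suc (Suc j)) ?W"
    using j by (simp add: id_take_nth_drop Cons_nth_drop_Suc)
  from spreadD[OF assms(1) rotate_infix[OF this]]
  have "1 \<le> parity_weight [?W ! j, ?W ! Suc j]"
    using assms(2) j by simp
  then show False
    by (simp add: eq parity_weight_twice)
qed

text \<open>The complement of \<open>S\<close> has at least \<open>k\<close> letters, so spread
  bounds the weight of \<open>S\<close> from below by its length.\<close>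

lemma distinct_if_spread:
  assumes "spread k T" "2 * k \<le> length T" "rotate p T = S @ R" "length S \<le> k"
  shows "distinct S"
proof (rule distinct_if_length_le_parity_weight)
  have "length S + length R = length T"
    using arg_cong[OF assms(3), of length] by simp
  then show "length S \<le> parity_weight S"
    using spreadD[OF assms(1,3)] assms(2,4) by linarith
qed

lemma spread_filter:
  assumes spread: "spread k T" and len: "2 * k \<le> length T" and bal: "balanced T"
  shows "spread (k - 1) (filter (\<lambda>t. t \<noteq> i) T)"
  unfolding spread_def
proof (intro allI impI)
  let ?P = "\<lambda>t. t \<noteq> i"
  fix q S' R' assume "rotate q (filter ?P T) = S' @ R'"
  then obtain p S R where rot: "rotate p T = S @ R"
    and S': "filter ?P S = S'" and R': "filter ?P R = R'"
    by (rule rotate_filterE)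
  show "min (k - 1) (min (length S') (length R')) \<le> parity_weight S'"
  proof (cases "k \<le> length S' \<and> k \<le> length R'")
    case True
    then have "k \<le> length S" "k \<le> length R"
      using S' R' length_filter_le by (metis le_trans)+
    then have "k \<le> parity_weight S"
      using spreadD[OF spread rot] by simp
    then show ?thesis
      using parity_weight_filter_ge[of S i] unfolding S' by linarith
  next
    case short: False
    \<comment> \<open>This bound looks at one arc only, so it serves for whichever of
      \<open>S'\<close> and \<open>R'\<close> is short.\<close>
    have main: "min (k - 1) (length A') \<le> parity_weight A'"
      if rot: "rotate p T = A @ B" and A': "filter ?P A = A'" and A'_short: "length A' < k"
      for p A B A'
    proof -
      let ?A1 = "take k A"
      have dist: "distinct ?A1"
        using distinct_if_spread[OF spread len, of p ?A1 "drop k A @ B"] rot by simp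
      have "A' = filter ?P ?A1 @ filter ?P (drop k A)"
        using A' by (metis append_take_drop_id filter_append)
      \<comment> \<open>If \<open>A\<close> is longer than \<open>k\<close>, its first
        \<open>k\<close> letters are distinct, so at least \<open>k - 1\<close> of them survive; as
        \<open>A'\<close> has no more letters than that, none comes from
        \<open>drop k A\<close>.\<close>
      moreover have "length (filter ?P (drop k A)) = 0"
      proof (cases "length A \<le> k")
        case False
        have "length (filter ?P ?A1) + count_list ?A1 i = k"
          using False by (simp add: length_filter_neq)
        moreover have "count_list ?A1 i \<le> 1"
          using dist by (simp add: count_list_distinct)
        moreover have "length (filter ?P ?A1) + length (filter ?P (drop k A)) = length A'"
          using calculation(1) \<open>A' = _\<close> by simp
        ultimately show ?thesis
          using A'_short by linarith
      qed simp
      ultimately have "distinct A'" using dist by simp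
      then show ?thesis by (simp add: parity_weight_distinct)
    qed
    have "balanced (S' @ R')"
      using \<open>rotate q _ = _\<close> bal by (metis balanced_filter balanced_rotate)
    then have "parity_weight R' = parity_weight S'"
      by (rule parity_weight_balanced_append)
    moreover have "rotate (p + length S) T = R @ S"
      using rotate_infix[of p T S R "[]"] rot by simp
    ultimately show ?thesis
      using short main[OF rot S'] main[OF _ R'] by fastforce
  qed
qed

lemma spread_if_spread_filter:
  assumes "2 \<le> k" and len: "4 * (k - 1) < length T" and bal: "balanced T"
    and spread1: "spread 1 T"
    and sub: "\<And>i. i \<in> set T \<Longrightarrow> spread (k - 1) (filter (\<lambda>t. t \<noteq> i) T)"
  shows "spread k T"
proof -
  have main: "min k (length S) \<le> parity_weight S"
    if rot: "rotate p T = S @ R" and le: "length S \<le> length R" for p S R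
  proof (rule ccontr)
    let ?D = "parity_weight S"
    assume "\<not> min k (length S) \<le> ?D"
    then have D: "?D < k" "?D < length S" by auto
    have len_eq: "length S + length R = length T"
      using arg_cong[OF rot, of length] by simp
    have adj: "distinct_adj (S @ R)"
      using distinct_adj_if_spread[OF spread1, of p] rot len \<open>2 \<le> k\<close> by simp
    have "1 \<le> ?D"
      using spreadD[OF spread1 rot] D(2) le by linarith
    have S_deleted: "length (filter (\<lambda>t. t \<noteq> i) S) \<le> ?D - 1"
      if "odd (count_list S i)" for i
    proof -
      let ?S = "filter (\<lambda>t. t \<noteq> i) S" and ?R = "filter (\<lambda>t. t \<noteq> i) R"
      have "i \<in> set T"
        using odd_letters_subset[of S] that rot by (metis Un_iff mem_Collect_eq set_append set_rotate subsetD)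
      obtain q where "rotate q (filter (\<lambda>t. t \<noteq> i) T) = ?S @ ?R"
        using rotate_filter_append[OF rot] .
      from spreadD[OF sub[OF \<open>i \<in> set T\<close>] this]
      have "min (k - 1) (min (length ?S) (length ?R)) \<le> ?D - 1"
        by (simp add: parity_weight_filter_odd that)
      \<comment> \<open>Since \<open>?D - 1 < k - 1\<close>, the minimum must be attained by a
        length.\<close>
      then have "length ?S \<le> ?D - 1 \<or> length ?R \<le> ?D - 1"
        using D(1) \<open>1 \<le> ?D\<close> by linarith
      moreover have "\<not> length ?R \<le> ?D - 1"
      proof
        assume "length ?R \<le> ?D - 1"
        moreover have "length R \<le> 2 * length ?R + 1"
          using adj by (intro length_le_double_filter_neq) auto
        ultimately show False
          using len len_eq le D(1) \<open>1 \<le> ?D\<close> by linarith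
      qed
      ultimately show ?thesis by blast
    qed
    obtain i where i: "odd (count_list S i)"
      using \<open>1 \<le> ?D\<close> unfolding parity_weight_def by (metis Collect_empty_eq card.empty not_one_le_zero)
    let ?S = "filter (\<lambda>t. t \<noteq> i) S"
    show False
    proof (cases "?D = 1")
      \<comment> \<open>Here \<open>S\<close> consists of copies of \<open>i\<close> alone; without
        equal neighbours its length is at most 1, contradicting
        \<open>?D < length S\<close>.\<close>
      case True
      moreover have "length S \<le> 2 * length ?S + 1"
        using adj by (intro length_le_double_filter_neq) auto
      ultimately show False using S_deleted[OF i] D(2) by linarith
    next
      case False
      have "\<exists>j. odd (count_list S j) \<and> j \<noteq> i"
      proof (rule ccontr)
        assume "\<not> ?thesis"
        then have "{c. odd (count_list S c)} = {i}" using i by auto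
        then show False using False by (simp add: parity_weight_def)
      qed
      then obtain j where j: "odd (count_list S j)" "j \<noteq> i" by blast
      \<comment> \<open>At most \<open>?D - 1\<close> letters remain, and their weight is exactly
        \<open>?D - 1\<close>.\<close>
      have "distinct ?S"
        using S_deleted[OF i] by (intro distinct_if_length_le_parity_weight)
          (simp add: parity_weight_filter_odd i)
      then have "count_list ?S j \<le> 1" by (simp add: count_list_distinct)
      then have "count_list S j \<le> 1" using j(2) by (simp add: count_list_filter)
      \<comment> \<open>Deleting \<open>j\<close> costs at most one letter, so \<open>S\<close> has
        length at most \<open>?D\<close>.\<close>
      then show False
        using S_deleted[OF j(1)] length_filter_neq[of j S] D(2) \<open>1 \<le> ?D\<close> by linarith
    qed
  qed
  show ?thesis
    unfolding spread_def
  proof (intro allI impI)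
    fix p S R assume rot: "rotate p T = S @ R"
    show "min k (min (length S) (length R)) \<le> parity_weight S"
    proof (cases "length S \<le> length R")
      case True
      then show ?thesis using main[OF rot] by simp
    next
      case False
      have "rotate (p + length S) T = R @ S"
        using rotate_infix[of p T S R "[]"] rot by simp
      moreover have "parity_weight R = parity_weight S"
        using rot bal by (metis balanced_rotate parity_weight_balanced_append)
      ultimately show ?thesis using main[of _ R S] False by fastforce
    qed
  qed
qed

section \<open>Distance in the hypercube\<close>

lemma graph_dist_eqI:
  assumes "(x, y) \<in> E ^^ n" "\<And>m. (x, y) \<in> E ^^ m \<Longrightarrow> n \<le> m"
  shows "graph_dist E x y = n"
  unfolding graph_dist_def using assms by (rule Least_equality)

definition hamming :: "bool list \<Rightarrow> bool list \<Rightarrow> nat" where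
  "hamming x y = card {c. c < length x \<and> x ! c \<noteq> y ! c}"

text \<open>Names the update in \<open>walk\<close>, so that \<open>fold flip S x\<close> is the
  endpoint of the walk from \<open>x\<close> along \<open>S\<close>.\<close>

definition flip :: "nat \<Rightarrow> bool list \<Rightarrow> bool list" where
  "flip t x = x[t := \<not> x ! t]"

lemma length_flip [simp]: "length (flip t x) = length x"
  by (simp add: flip_def)

lemma length_fold_flip [simp]: "length (fold flip S x) = length x"
  by (induction S arbitrary: x) auto

lemma nth_flip: "c < length x \<Longrightarrow> flip t x ! c = (x ! c \<noteq> (t = c))"
  by (auto simp: flip_def nth_list_update)

lemma nth_fold_flip:
  "c < length x \<Longrightarrow> fold flip S x ! c = (x ! c \<noteq> odd (count_list S c))"
  by (induction S arbitrary: x) (auto simp: nth_flip)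

lemma fold_flip_balanced: "balanced T \<Longrightarrow> fold flip T x = x"
  by (rule nth_equalityI) (auto simp: nth_fold_flip balanced_def)

text \<open>The letters must be coordinates, as updates out of range change nothing but would be
  counted.\<close>

lemma hamming_fold_flip:
  assumes "set S \<subseteq> {..<length x}"
  shows "hamming x (fold flip S x) = parity_weight S"
  unfolding hamming_def parity_weight_def
  using assms odd_letters_subset[of S]
  by (intro arg_cong[where f = card]) (auto simp: nth_fold_flip)

lemma hypercube_flip: "t < length x \<Longrightarrow> (x, flip t x) \<in> hypercube (length x)"
  unfolding hypercube_def by (auto simp: nth_flip)

lemma hypercube_imp_flip:
  assumes "(x, y) \<in> hypercube n"
  shows "length x = n" "transition x y < n" "y = flip (transition x y) x"
proof -
  from assms have len: "length x = n" "length y = n"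
    and ex: "\<exists>!p. p < n \<and> x ! p \<noteq> y ! p"
    by (auto simp: hypercube_def)
  show "length x = n" by (fact len)
  have t: "transition x y < n \<and> x ! transition x y \<noteq> y ! transition x y"
    unfolding transition_def len(1) using ex by (rule theI')
  then show "transition x y < n" by blast
  show "y = flip (transition x y) x"
    using t ex len by (intro nth_equalityI) (auto simp: nth_flip)
qed

text \<open>An edge changes a single coordinate, so the number of differences grows by at most one
  per step.\<close>

lemma hamming_le_hypercube_walk:
  assumes "(x, y) \<in> hypercube n ^^ m" "length x = n"
  shows "hamming x y \<le> m"
  using assms(1)
proof (induction m arbitrary: y)
  case 0
  then show ?case by (simp add: hamming_def)
next
  case (Suc m)
  then obtain z where z: "(x, z) \<in> hypercube n ^^ m" "(z, y) \<in> hypercube n" by auto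
  have "{c. c < length x \<and> x ! c \<noteq> y ! c}
      \<subseteq> insert (transition z y) {c. c < length x \<and> x ! c \<noteq> z ! c}"
  proof
    fix c assume c: "c \<in> {c. c < length x \<and> x ! c \<noteq> y ! c}"
    then have "y ! c = (z ! c \<noteq> (transition z y = c))"
      using hypercube_imp_flip[OF z(2)] assms(2) by (metis mem_Collect_eq nth_flip)
    with c show "c \<in> insert (transition z y) {c. c < length x \<and> x ! c \<noteq> z ! c}" by auto
  qed
  then have "hamming x y \<le> card (insert (transition z y) {c. c < length x \<and> x ! c \<noteq> z ! c})"
    unfolding hamming_def by (intro card_mono) auto
  also have "\<dots> \<le> Suc (hamming x z)"
    unfolding hamming_def by (rule card_insert_le_m1) auto
  finally show ?case using Suc.IH[OF z(1)] by linarith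
qed

text \<open>The walk corrects the differing coordinates one by one.\<close>

lemma hypercube_walk_hamming:
  assumes "length x = n" "length y = n"
  shows "(x, y) \<in> hypercube n ^^ hamming x y"
  using assms(1)
proof (induction "hamming x y" arbitrary: x)
  case 0
  then have "x = y" using assms(2) by (intro nth_equalityI) (auto simp: hamming_def)
  then show ?case by (simp add: hamming_def)
next
  case (Suc m)
  then have "{c. c < length x \<and> x ! c \<noteq> y ! c} \<noteq> {}"
    unfolding hamming_def by (metis card.empty nat.distinct(1))
  then obtain t where t: "t < length x" "x ! t \<noteq> y ! t" by blast
  have "{c. c < length (flip t x) \<and> flip t x ! c \<noteq> y ! c}
      = {c. c < length x \<and> x ! c \<noteq> y ! c} - {t}"
    using t by (auto simp: nth_flip)
  then have "m = hamming (flip t x) y"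
    using Suc.hyps(2) t by (simp add: hamming_def)
  with Suc.hyps(1)[OF this] Suc.prems have "(flip t x, y) \<in> hypercube n ^^ m" by simp
  moreover have "(x, flip t x) \<in> hypercube n" using hypercube_flip[OF t(1)] Suc.prems by simp
  ultimately show ?case unfolding Suc.hyps(2)[symmetric] by (rule relpow_Suc_I2[rotated])
qed

lemma graph_dist_hypercube:
  "length x = n \<Longrightarrow> length y = n \<Longrightarrow> graph_dist (hypercube n) x y = hamming x y"
  by (intro graph_dist_eqI hypercube_walk_hamming hamming_le_hypercube_walk)

section \<open>Distance in a cycle\<close>

lemma cycle_graph_iff:
  "(u, v) \<in> cycle_graph C \<longleftrightarrow>
     (\<exists>j<length C. (u = C ! j \<and> v = C ! (Suc j mod length C)) \<or>
                   (v = C ! j \<and> u = C ! (Suc j mod length C)))"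
  by (auto simp: cycle_graph_def)

text \<open>Rotation only shifts the numbering of the edges cyclically. Hence distances need to be
  computed only from index 0.\<close>

lemma cycle_graph_rotate1: "cycle_graph (rotate1 C) = cycle_graph C"
proof (cases "C = []")
  case False
  let ?N = "length C" and ?e = "\<lambda>C j. {(C ! j, C ! (Suc j mod length C)), (C ! (Suc j mod length C), C ! j)}"
  have "?e (rotate1 C) j = ?e C (Suc j mod ?N)" if "j < ?N" for j
    using that False by (simp add: nth_rotate1 mod_Suc_eq)
  then have "cycle_graph (rotate1 C) = \<Union> (?e C ` (\<lambda>j. Suc j mod ?N) ` {..<?N})"
    unfolding cycle_graph_def image_image by (intro arg_cong[where f = Union] image_cong) auto
  also have "(\<lambda>j. Suc j mod ?N) ` {..<?N} = {..<?N}"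
  proof (intro equalityI subsetI)
    fix j assume "j \<in> {..<?N}"
    then show "j \<in> (\<lambda>j. Suc j mod ?N) ` {..<?N}"
      by (intro image_eqI[of _ _ "if j = 0 then ?N - 1 else j - 1"]) auto
  qed (use False in auto)
  finally show ?thesis by (simp add: cycle_graph_def)
qed (simp add: cycle_graph_def)

lemma cycle_graph_rotate: "cycle_graph (rotate p C) = cycle_graph C"
  by (induction p) (simp_all add: cycle_graph_rotate1)

lemma cycle_graph_walk_forward:
  "q < length C \<Longrightarrow> (C ! 0, C ! q) \<in> cycle_graph C ^^ q"
proof (induction q)
  case (Suc q)
  then have "(C ! q, C ! Suc q) \<in> cycle_graph C"
    unfolding cycle_graph_iff by (intro exI[of _ q]) simp
  with Suc show ?case by auto
qed simp

text \<open>The \<open>mod\<close> matters only for \<open>q = 0\<close>, where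
  \<open>length C\<close> would be out of range.\<close>

lemma cycle_graph_walk_backward:
  "q \<le> length C \<Longrightarrow> (C ! 0, C ! ((length C - q) mod length C)) \<in> cycle_graph C ^^ q"
proof (induction q)
  case (Suc q)
  let ?j = "length C - Suc q"
  have j: "?j < length C" "Suc ?j = length C - q" using Suc.prems by auto
  then have "(C ! ((length C - q) mod length C), C ! ?j) \<in> cycle_graph C"
    unfolding cycle_graph_iff by (intro exI[of _ ?j]) simp
  with Suc j(1) show ?case by auto
qed simp

text \<open>Along an edge, \<open>min q (length C - q)\<close> grows by at most one; distinctness
  lets a vertex determine its index.\<close>

lemma cycle_graph_walk_bound:
  assumes "distinct C" "(C ! 0, v) \<in> cycle_graph C ^^ m" "C \<noteq> []"
  shows "\<exists>q<length C. v = C ! q \<and> min q (length C - q) \<le> m"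
  using assms(2)
proof (induction m arbitrary: v)
  case 0
  then show ?case using assms(3) by auto
next
  case (Suc m)
  then obtain u where u: "(C ! 0, u) \<in> cycle_graph C ^^ m" "(u, v) \<in> cycle_graph C" by auto
  obtain q where q: "q < length C" "u = C ! q" "min q (length C - q) \<le> m"
    using Suc.IH[OF u(1)] by blast
  obtain j where j: "j < length C"
    "u = C ! j \<and> v = C ! (Suc j mod length C) \<or> v = C ! j \<and> u = C ! (Suc j mod length C)"
    using u(2) unfolding cycle_graph_iff by blast
  let ?j' = "Suc j mod length C"
  have j': "?j' < length C" "?j' = Suc j \<or> ?j' = 0 \<and> Suc j = length C"
    using j(1) by (auto simp: mod_Suc)
  from j(2) show ?case
  proof (elim disjE conjE)
    assume "u = C ! j" "v = C ! ?j'"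
    then have "q = j" using q(1,2) j(1) assms(1) by (simp add: nth_eq_iff_index_eq)
    then have "min ?j' (length C - ?j') \<le> Suc m" using q j' by auto
    then show ?thesis using j'(1) \<open>v = C ! ?j'\<close> by blast
  next
    assume "v = C ! j" "u = C ! ?j'"
    then have "q = ?j'" using q(1,2) j'(1) assms(1) by (simp add: nth_eq_iff_index_eq)
    then have "min j (length C - j) \<le> Suc m" using q j' by auto
    then show ?thesis using j(1) \<open>v = C ! j\<close> by blast
  qed
qed

lemma graph_dist_cycle_graph:
  assumes "distinct C" "q < length C"
  shows "graph_dist (cycle_graph C) (C ! 0) (C ! q) = min q (length C - q)"
proof (rule graph_dist_eqI)
  show "(C ! 0, C ! q) \<in> cycle_graph C ^^ min q (length C - q)"
    using cycle_graph_walk_forward[OF assms(2)] cycle_graph_walk_backward[of "length C - q" C]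
      assms(2) by (simp add: min_def)
next
  fix m assume "(C ! 0, C ! q) \<in> cycle_graph C ^^ m"
  from cycle_graph_walk_bound[OF assms(1) this]
  obtain r where "r < length C" "C ! q = C ! r" "min r (length C - r) \<le> m"
    using assms(2) by fastforce
  then show "min q (length C - q) \<le> m"
    using assms by (simp add: nth_eq_iff_index_eq)
qed

section \<open>Closed walks and their transition words\<close>

lemma walk_append: "walk x (S @ R) = walk x S @ walk (fold flip S x) R"
  by (induction S arbitrary: x) (simp_all add: flip_def)

lemma length_walk [simp]: "length (walk x T) = length T"
  by (induction T arbitrary: x) simp_all

lemma nth_walk: "j < length T \<Longrightarrow> walk x T ! j = fold flip (take j T) x"
  by (induction T arbitrary: x j) (auto simp: flip_def less_Suc_eq_0_disj)

text \<open>As the walk is closed, reading it from a later vertex \<open>y\<close> gives the walk of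
  the rotated word. Distances do not depend on the start, so of \<open>y\<close> only the length is
  recorded.\<close>

lemma rotate_walk:
  assumes "balanced T"
  shows "\<exists>y. length y = length x \<and> rotate p (walk x T) = walk y (rotate p T)"
proof (induction p)
  case (Suc p)
  then obtain y where y: "length y = length x" "rotate p (walk x T) = walk y (rotate p T)"
    by blast
  show ?case
  proof (cases "rotate p T")
    case Nil
    then show ?thesis using y by auto
  next
    case (Cons t ts)
    have "fold flip ts (flip t y) = y"
      using fold_flip_balanced[OF balanced_rotate[OF assms], of p y] Cons by simp
    then have "rotate1 (walk y (rotate p T)) = walk (flip t y) (rotate1 (rotate p T))"
      by (simp add: Cons walk_append flip_def)
    then show ?thesis using y by (intro exI[of _ "flip t y"]) simp
  qed
qed auto

lemma circuit_walk_edges: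
  assumes "balanced T" "set T \<subseteq> {..<length x}" "j < length T"
  shows "(walk x T ! j, walk x T ! (Suc j mod length (walk x T))) \<in> hypercube (length x)"
proof -
  have "walk x T ! (Suc j mod length (walk x T)) = fold flip (take (Suc j) T) x"
  proof (cases "Suc j = length T")
    \<comment> \<open>The closing edge: the index wraps to 0 and the whole word leads back to
      \<open>x\<close>.\<close>
    case True
    then show ?thesis
      using assms by (subst nth_walk) (auto simp: fold_flip_balanced)
  qed (use assms(3) in \<open>simp add: nth_walk\<close>)
  also have "\<dots> = flip (T ! j) (walk x T ! j)"
    using assms(3) by (simp add: nth_walk take_Suc_conv_app_nth)
  finally show ?thesis
    using hypercube_flip[of "T ! j" "walk x T ! j"] assms(3) subsetD[OF assms(2) nth_mem[OF assms(3)]]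
    by (simp add: nth_walk)
qed

text \<open>Normal form for pairs: after a rotation one vertex has index 0, and the arc to the other
  is a prefix of the rotated word.\<close>

lemma vertex_pairs_walk:
  assumes "balanced T"
  shows "u \<in> set (walk x T) \<and> v \<in> set (walk x T) \<longleftrightarrow>
    (\<exists>p q. q < length T \<and> u = rotate p (walk x T) ! 0 \<and> v = rotate p (walk x T) ! q)"
    (is "?L \<longleftrightarrow> ?R")
proof
  assume ?R
  then show ?L by (metis gr_implies_not_zero gr0I length_rotate length_walk nth_mem set_rotate)
next
  assume ?L
  then obtain p where p: "p < length T" "u = walk x T ! p" by (metis in_set_conv_nth length_walk)
  from \<open>?L\<close> have "v \<in> set (rotate p (walk x T))" by simp
  then obtain q where "q < length T" "v = rotate p (walk x T) ! q"
    by (metis in_set_conv_nth length_rotate length_walk)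
  moreover have "u = rotate p (walk x T) ! 0"
    using p by (subst nth_rotate) auto
  ultimately show ?R by blast
qed

lemma graph_dist_hypercube_walk:
  assumes "balanced T" "set T \<subseteq> {..<length x}" "q < length T"
  shows "graph_dist (hypercube (length x)) (rotate p (walk x T) ! 0) (rotate p (walk x T) ! q)
    = parity_weight (take q (rotate p T))"
proof -
  obtain y where y: "length y = length x" "rotate p (walk x T) = walk y (rotate p T)"
    using rotate_walk[OF assms(1)] by blast
  have "set (take q (rotate p T)) \<subseteq> {..<length y}"
    using assms(2) y(1) set_take_subset[of q "rotate p T"] by auto
  moreover have "0 < length T" using assms(3) by auto
  ultimately show ?thesis
    using assms(3) y by (simp add: nth_walk graph_dist_hypercube hamming_fold_flip)
qed

lemma graph_dist_cycle_walk:
  assumes "distinct (walk x T)" "q < length T"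
  shows "graph_dist (cycle_graph (walk x T)) (rotate p (walk x T) ! 0) (rotate p (walk x T) ! q)
    = min q (length T - q)"
  using graph_dist_cycle_graph[of "rotate p (walk x T)" q] assms
  by (simp add: cycle_graph_rotate)

text \<open>Cube distance is the weight of an arc, cycle distance the length of the shorter arc. The
  weight never exceeds that length, so the lower bound in \<open>spread\<close> turns a distance
  below \<open>k\<close> into an equality.\<close>

lemma circuit_code_walk_iff:
  assumes bal: "balanced T" and letters: "set T \<subseteq> {..<length x}" and "1 \<le> k"
  shows "circuit_code (length x) k (walk x T) \<longleftrightarrow> 3 \<le> length T \<and> spread k T"
proof
  assume code: "circuit_code (length x) k (walk x T)"
  then have circ: "3 \<le> length T" "distinct (walk x T)"
    by (auto simp: circuit_code_def circuit_def)
  have "spread k T"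
    unfolding spread_def
  proof (intro allI impI)
    fix p S R assume rot: "rotate p T = S @ R"
    then have len: "length S + length R = length T"
      by (metis length_append length_rotate)
    show "min k (min (length S) (length R)) \<le> parity_weight S"
    proof (cases "length S < length T")
      case True
      let ?u = "rotate p (walk x T) ! 0" and ?v = "rotate p (walk x T) ! length S"
      have "?u \<in> set (walk x T) \<and> ?v \<in> set (walk x T)"
        using vertex_pairs_walk[OF bal] True by blast
      then have "parity_weight S < k \<longrightarrow> min (length S) (length T - length S) = parity_weight S"
        using code graph_dist_hypercube_walk[OF bal letters True, of p] rot
          graph_dist_cycle_walk[OF circ(2) True, of p]
        by (auto simp: circuit_code_def)
      then show ?thesis using len by linarith
    qed (use len in simp)
  qed
  with circ(1) show "3 \<le> length T \<and> spread k T" by blast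
next
  assume "3 \<le> length T \<and> spread k T"
  then have spread: "spread k T" and len: "3 \<le> length T" by blast+
  have lower: "min k (min q (length T - q)) \<le> parity_weight (take q (rotate p T))"
    if "q < length T" for p q
    using spreadD[OF spread, of p "take q (rotate p T)" "drop q (rotate p T)"] that by simp
  have upper: "parity_weight (take q (rotate p T)) \<le> min q (length T - q)"
    if "q < length T" for p q
  proof -
    have "parity_weight (drop q (rotate p T)) = parity_weight (take q (rotate p T))"
      by (rule parity_weight_balanced_append) (simp add: bal balanced_rotate)
    then show ?thesis
      using parity_weight_le_length[of "take q (rotate p T)"] that
        parity_weight_le_length[of "drop q (rotate p T)"] by simp
  qed
  \<comment> \<open>A repeated vertex gives an arc of weight 0 that is neither empty nor full,
    against \<open>1 \<le> k\<close>.\<close>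
  have dist: "distinct (walk x T)"
  proof (rule ccontr)
    assume "\<not> distinct (walk x T)"
    then obtain a b where ab: "a < b" "b < length T" "walk x T ! a = walk x T ! b"
      by (auto simp: distinct_conv_nth) (metis linorder_neqE_nat)
    let ?u = "rotate a (walk x T) ! 0" and ?v = "rotate a (walk x T) ! (b - a)"
    have "?u = walk x T ! a" "?v = walk x T ! b"
      using ab(1,2) by (subst nth_rotate; auto)+
    then have "?u = ?v" using ab(3) by simp
    then have "graph_dist (hypercube (length x)) ?u ?v = 0"
      by (intro graph_dist_eqI) auto
    then have "parity_weight (take (b - a) (rotate a T)) = 0"
      using graph_dist_hypercube_walk[OF bal letters, of "b - a" a] ab by simp
    moreover have "b - a < length T" using ab(2) by simp
    ultimately show False using lower[of "b - a" a] ab(1) \<open>1 \<le> k\<close> by linarith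
  qed
  have "circuit (length x) (walk x T)"
    using len dist circuit_walk_edges[OF bal letters] by (simp add: circuit_def)
  moreover have "graph_dist (cycle_graph (walk x T)) u v = graph_dist (hypercube (length x)) u v"
    if uv: "u \<in> set (walk x T)" "v \<in> set (walk x T)"
      and close: "graph_dist (hypercube (length x)) u v < k" for u v
  proof -
    obtain p q where pq: "q < length T"
      "u = rotate p (walk x T) ! 0" "v = rotate p (walk x T) ! q"
      using uv vertex_pairs_walk[OF bal] by blast
    show ?thesis
      using close lower[OF pq(1), of p] upper[OF pq(1), of p]
      unfolding pq(2,3) graph_dist_hypercube_walk[OF bal letters pq(1)]
        graph_dist_cycle_walk[OF dist pq(1)] by linarith
  qed
  ultimately show "circuit_code (length x) k (walk x T)"
    by (simp add: circuit_code_def)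
qed

section \<open>Circuits and subcircuits as closed walks\<close>

text \<open>Distance below 1 means equal vertices. This supplies the \<open>spread 1\<close> assumed
  in \<open>spread_if_spread_filter\<close>.\<close>

lemma circuit_code_1:
  assumes "circuit d C"
  shows "circuit_code d 1 C"
  unfolding circuit_code_def
proof (intro conjI ballI impI)
  have len: "length x = d" if "x \<in> set C" for x
    using that assms by (auto simp: circuit_def in_set_conv_nth hypercube_def)
  fix x y assume "x \<in> set C" "y \<in> set C" "graph_dist (hypercube d) x y < 1"
  then have "x = y"
    using hypercube_walk_hamming[of x d y] len by (simp add: graph_dist_hypercube)
  then show "graph_dist (cycle_graph C) x y = graph_dist (hypercube d) x y"
    using graph_dist_eqI[of x y 0] by simp
qed (fact assms)

lemma length_transition_sequence [simp]: "length (transition_sequence C) = length C"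
  by (simp add: transition_sequence_def)

lemma circuit_eq_walk:
  assumes "circuit d C"
  defines "T \<equiv> transition_sequence C"
  shows "length (hd C) = d" "balanced T" "set T \<subseteq> {..<d}" "walk (hd C) T = C"
proof -
  have "C \<noteq> []" using assms by (auto simp: circuit_def)
  have T: "C ! (Suc j mod length C) = flip (T ! j) (C ! j)" "T ! j < d" "length (C ! j) = d"
    if "j < length C" for j
    using that assms hypercube_imp_flip[of "C ! j" "C ! (Suc j mod length C)" d]
    by (auto simp: circuit_def transition_sequence_def)
  show len: "length (hd C) = d"
    using T(3)[of 0] \<open>C \<noteq> []\<close> by (simp add: hd_conv_nth)
  show letters: "set T \<subseteq> {..<d}"
    using T(2) by (auto simp: in_set_conv_nth T_def)
  \<comment> \<open>The \<open>mod\<close> makes the case \<open>j = length C\<close> express that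
    the walk returns to its start.\<close>
  have step: "fold flip (take j T) (hd C) = C ! (j mod length C)" if "j \<le> length C" for j
    using that
  proof (induction j)
    case 0
    then show ?case using \<open>C \<noteq> []\<close> by (simp add: hd_conv_nth)
  next
    case (Suc j)
    then have "j < length T" by (simp add: T_def)
    then show ?case using Suc T(1)[of j] by (simp add: take_Suc_conv_app_nth T_def)
  qed
  show "walk (hd C) T = C"
    using step by (intro nth_equalityI) (simp_all add: nth_walk T_def)
  have "fold flip T (hd C) = hd C"
    using step[of "length C"] \<open>C \<noteq> []\<close> by (simp add: T_def hd_conv_nth)
  then have "even (count_list T c)" for c
  proof (cases "c < d")
    case True
    then show ?thesis using nth_fold_flip[of c "hd C" T] len \<open>fold flip T _ = _\<close> by auto
  next
    case False
    then have "count_list T c = 0" using letters by (intro count_notin) auto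
    then show ?thesis by simp
  qed
  then show "balanced T" by (simp add: balanced_def)
qed

text \<open>Renumbers the coordinates other than \<open>i\<close> in accordance with \<^const>\<open>delete_coord\<close>.\<close>
definition skip_coord :: "nat \<Rightarrow> nat \<Rightarrow> nat" where
  "skip_coord i t = (if t < i then t else t - 1)"

lemma inj_on_skip_coord: "inj_on (skip_coord i) {t. t \<noteq> i}"
  by (auto simp: inj_on_def skip_coord_def split: if_splits)

lemma length_delete_coord: "i < length x \<Longrightarrow> length (delete_coord i x) = length x - 1"
  by (simp add: delete_coord_def)

lemma nth_delete_coord:
  "i < length x \<Longrightarrow> c < length x - 1 \<Longrightarrow>
    delete_coord i x ! c = x ! (if c < i then c else Suc c)"
  by (simp add: delete_coord_def nth_append)

lemma delete_coord_flip:
  assumes "i < length x" "t \<noteq> i"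
  shows "delete_coord i (flip t x) = flip (skip_coord i t) (delete_coord i x)"
proof (rule nth_equalityI)
  fix c assume "c < length (delete_coord i (flip t x))"
  then have "c < length x - 1" using assms(1) by (simp add: length_delete_coord)
  moreover from this have "(if c < i then c else Suc c) < length x" by auto
  ultimately show "delete_coord i (flip t x) ! c = flip (skip_coord i t) (delete_coord i x) ! c"
    using assms
    by (auto simp: nth_flip nth_delete_coord length_delete_coord skip_coord_def split: if_splits)
qed (use assms in \<open>simp add: length_delete_coord\<close>)

lemma map_delete_coord_walk:
  "i < length x \<Longrightarrow> i \<notin> set T \<Longrightarrow>
    map (delete_coord i) (walk x T) = walk (delete_coord i x) (map (skip_coord i) T)"
proof (induction T arbitrary: x)
  case (Cons t T)
  then show ?case
    using delete_coord_flip[of i x t] Cons.IH[of "flip t x"] by (simp add: flip_def)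
qed simp

text \<open>Removing coordinate \<open>i\<close> from the vertices renames the letters by
  \<open>skip_coord i\<close>, and spread is invariant under injective renaming.\<close>

lemma circuit_code_subcircuit_iff:
  assumes "circuit d C" "i < d" "1 \<le> k"
  defines "T' \<equiv> filter (\<lambda>t. t \<noteq> i) (transition_sequence C)"
  shows "circuit_code (d - 1) k (subcircuit d i C) \<longleftrightarrow> 3 \<le> length T' \<and> spread k T'"
proof -
  let ?x = "delete_coord i (replicate d False)"
  note T = circuit_eq_walk[OF assms(1)]
  have len: "length ?x = d - 1" using assms(2) by (simp add: length_delete_coord)
  have inj: "inj_on (skip_coord i) (set T')"
    by (rule inj_on_subset[OF inj_on_skip_coord]) (auto simp: T'_def)
  have "balanced (map (skip_coord i) T')"
    using T(2) inj unfolding T'_def by (intro balanced_map balanced_filter)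
  moreover have "set (map (skip_coord i) T') \<subseteq> {..<length ?x}"
  proof -
    have "skip_coord i t < d - 1" if "t < d" "t \<noteq> i" for t
      using that assms(2) by (auto simp: skip_coord_def)
    then show ?thesis using T(3) len by (auto simp: T'_def)
  qed
  moreover have "subcircuit d i C = walk ?x (map (skip_coord i) T')"
    unfolding subcircuit_def T'_def using assms(2) by (intro map_delete_coord_walk) auto
  ultimately show ?thesis
    using circuit_code_walk_iff[of "map (skip_coord i) T'" ?x k] assms(3) len spread_map[OF inj]
    by simp
qed

theorem theorem4p4:
  fixes d k :: nat and C :: "bool list list"
  assumes "2 \<le> k" and "k \<le> d"
    and "circuit d C"
    and "hd C = replicate d False"
    and "length C > 4 * (k - 1)"
    and "set (transition_sequence C) = {..<d}"
  shows "circuit_code d k C \<longleftrightarrow>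
    (\<forall>i<d. circuit_code (d - 1) (k - 1) (subcircuit d i C))"
proof -
  let ?T = "transition_sequence C"
  let ?T' = "\<lambda>i. filter (\<lambda>t. t \<noteq> i) ?T"
  note T = circuit_eq_walk[OF \<open>circuit d C\<close>]
  have code: "circuit_code d j C \<longleftrightarrow> spread j ?T" if "1 \<le> j" for j
    using circuit_code_walk_iff[OF T(2), of "hd C" j] T that \<open>circuit d C\<close>
    by (simp add: circuit_def)
  have spread1: "spread 1 ?T"
    using circuit_code_1[OF \<open>circuit d C\<close>] code[of 1] by simp
  \<comment> \<open>From \<open>2 \<le> k\<close> follow \<open>4 \<le> 4 * (k - 1)\<close> and
    \<open>2 * k \<le> 4 * (k - 1)\<close>.\<close>
  have len: "5 \<le> length ?T" "2 * k \<le> length ?T"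
    using assms(1,5) by auto
  \<comment> \<open>The length of \<open>?T\<close> is even, hence at least 6, so at least 5/2 and
    thus 3 letters survive the deletion.\<close>
  have len': "3 \<le> length (?T' i)" for i
  proof -
    have "distinct_adj ?T"
      using distinct_adj_if_spread[OF spread1, of 0] len(1) by simp
    then have "length ?T \<le> 2 * length (?T' i) + 1"
      by (rule length_le_double_filter_neq)
    moreover have "even (length ?T)" "even (length (?T' i))"
      by (intro even_length_balanced balanced_filter T(2))+
    ultimately show ?thesis using len(1) by presburger
  qed
  have sub: "circuit_code (d - 1) (k - 1) (subcircuit d i C) \<longleftrightarrow> spread (k - 1) (?T' i)"
    if "i < d" for i
    using circuit_code_subcircuit_iff[OF \<open>circuit d C\<close> that, of "k - 1"] len' assms(1) by simp
  \<comment> \<open>As every coordinate occurs, the letters \<open>i\<close> in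
    \<open>spread_if_spread_filter\<close> range over exactly the \<open>i < d\<close>.\<close>
  show ?thesis
    using code[of k] sub spread_filter[OF _ len(2) T(2)]
      spread_if_spread_filter[OF assms(1) _ T(2) spread1] assms(1,5,6)
    by auto
qed

end
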